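(* There is an absolute constant $C>0$ such that the following holds. Let $B\in\mathbb{C}^{m\times n}$, $E\in\mathbb{C}^{s\times n}$, $A=\begin{pmatrix}B\\ E\end{pmatrix}\in\mathbb{C}^{(m+s)\times n}$, and let $1\le k<\min(m,n)$. Let $\lambda\in\mathbb{R}$ satisfy $\lambda\ge\widehat{\sigma}_1^2$ and be such that $BB^H-\lambda I_m$ is invertible, let $$B(\lambda)=(I_m-U_kU_k^H)(BB^H-\lambda I_m)^{-1},$$ and define $$Z=\begin{pmatrix}u^{(1)},\ldots,u^{(k)} & -B(\lambda)BE^H & 0\\ 0 & 0 & I_s\end{pmatrix}\in\mathbb{C}^{(m+s)\times(k+2s)}.$$ For any $i=1,\ldots,k$ with $\widehat{\sigma}_i\neq\sigma_{k+1}$, let $\widehat{y}^{(i)}\in\mathbb{C}^s$ be the vector of the last $s$ entries of the left singular vector $\widehat{u}^{(i)}$ of $A$ associated with $\widehat{\sigma}_i$, and set $\gamma=C\left\|E^H\widehat{y}^{(i)}\right\|$. Then $$\min_{z\in\mathrm{range}(Z)}\left\|\widehat{u}^{(i)}-z\right\|\le\left|\frac{\gamma\,\sigma_{k+1}(\widehat{\sigma}_i^2-\lambda)}{(\sigma_{k+1}^2-\widehat{\sigma}_i^2)(\sigma_{k+1}^2-\lambda)}\right|.$$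
   Context: The full SVD of $B$ is $B=U\Sigma V^H$, where $U\in\mathbb{C}^{m\times m}$ and $V\in\mathbb{C}^{n\times n}$ are unitary with $j$-th columns $u^{(j)}$ and $v^{(j)}$ (left and right singular vectors of $B$), and $\Sigma\in\mathbb{R}^{m\times n}$ has nonzero entries only on its main diagonal, equal to the singular values $\sigma_1\ge\cdots\ge\sigma_{\min(m,n)}\ge 0$. $U_k=[u^{(1)},\ldots,u^{(k)}]$. The singular values of $A$ are $\widehat{\sigma}_1\ge\widehat{\sigma}_2\ge\cdots\ge 0$, with left singular vectors $\widehat{u}^{(1)},\widehat{u}^{(2)},\ldots$ from a full SVD of $A$. $I_p$ denotes the $p\times p$ identity matrix, ${}^H$ the conjugate transpose, $\|\cdot\|$ the Euclidean norm of vectors, and $\mathrm{range}(Z)$ the column space of $Z$. *)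

theory Defs
  imports
    "HOL-Analysis.L2_Norm"
    "Jordan_Normal_Form.Schur_Decomposition"
    "Jordan_Normal_Form.Gauss_Jordan_Elimination"
    "Jordan_Normal_Form.VS_Connect"
begin

definition cvec_norm :: "complex vec \<Rightarrow> real" where
  "cvec_norm v = L2_set (\<lambda>i. cmod (v $ i)) {..<dim_vec v}"

definition unitary_mat :: "nat \<Rightarrow> complex mat \<Rightarrow> bool" where
  "unitary_mat n U \<longleftrightarrow>
     U \<in> carrier_mat n n \<and> mat_adjoint U * U = 1\<^sub>m n \<and> U * mat_adjoint U = 1\<^sub>m n"

(* Matrix entries and columns are indexed from 0 in Jordan_Normal_Form; sing_val and
   sing_vec index from 1, so that sing_val S 1 is the largest singular value. *)

definition sing_val :: "real mat \<Rightarrow> nat \<Rightarrow> real" where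
  "sing_val S j = S $$ (j - 1, j - 1)"

definition sing_vec :: "complex mat \<Rightarrow> nat \<Rightarrow> complex vec" where
  "sing_vec U j = col U (j - 1)"

definition full_svd ::
  "nat \<Rightarrow> nat \<Rightarrow> complex mat \<Rightarrow> complex mat \<Rightarrow> real mat \<Rightarrow> complex mat \<Rightarrow> bool" where
  "full_svd m n M U S V \<longleftrightarrow>
     unitary_mat m U \<and> unitary_mat n V \<and>
     S \<in> carrier_mat m n \<and> diagonal_mat S \<and>
     (\<forall>j \<in> {1..min m n}. 0 \<le> sing_val S j) \<and>
     (\<forall>i \<in> {1..min m n}. \<forall>j \<in> {1..min m n}. i \<le> j \<longrightarrow> sing_val S j \<le> sing_val S i) \<and>
     M = U * map_mat complex_of_real S * mat_adjoint V"

definition leading_cols :: "nat \<Rightarrow> complex mat \<Rightarrow> complex mat" where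
  "leading_cols k U = mat_of_cols (dim_row U) (map (sing_vec U) [1..<k + 1])"

definition append_cols :: "complex mat \<Rightarrow> complex mat \<Rightarrow> complex mat" where
  "append_cols M N = four_block_mat M N (0\<^sub>m 0 (dim_col M)) (0\<^sub>m 0 (dim_col N))"

definition shifted_gram :: "complex mat \<Rightarrow> real \<Rightarrow> complex mat" where
  "shifted_gram B lam = B * mat_adjoint B - complex_of_real lam \<cdot>\<^sub>m 1\<^sub>m (dim_row B)"

(* The matrix B(lambda), meaningful when shifted_gram B lam is invertible;
   mat_inverse returns None on singular matrices. *)
definition B_lam :: "complex mat \<Rightarrow> complex mat \<Rightarrow> nat \<Rightarrow> real \<Rightarrow> complex mat" where
  "B_lam B U k lam =
     (1\<^sub>m (dim_row B) - leading_cols k U * mat_adjoint (leading_cols k U)) *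
     the (mat_inverse (shifted_gram B lam))"

definition Z_mat ::
  "complex mat \<Rightarrow> complex mat \<Rightarrow> complex mat \<Rightarrow> nat \<Rightarrow> real \<Rightarrow> complex mat" where
  "Z_mat B E U k lam =
     four_block_mat
       (append_cols (leading_cols k U) (- (B_lam B U k lam * B * mat_adjoint E)))
       (0\<^sub>m (dim_row B) (dim_row E))
       (0\<^sub>m (dim_row E) (k + dim_row E))
       (1\<^sub>m (dim_row E))"

definition mat_range :: "complex mat \<Rightarrow> complex vec set" where
  "mat_range M = vec_space.col_space (dim_row M) M"

end

theory Submission
  imports Defs
begin

text \<open>Write the left singular vector as \<open>u = (x; y)\<close> and let \<open>t\<close> be its singular value. The first block row of
\<open>A A\<^sup>H u = t\<^sup>2 u\<close> reads \<open>B B\<^sup>H x + B q = t\<^sup>2 x\<close> with \<open>q = E\<^sup>H y\<close>. So in the basis of the left singular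
vectors of \<open>B\<close>, a coordinate of \<open>x\<close> with singular value \<open>d\<^sub>j \<noteq> t\<close> is \<open>- b\<^sub>j / (d\<^sub>j\<^sup>2 - t\<^sup>2)\<close>, where \<open>b\<^sub>j\<close> is
\<open>d\<^sub>j\<close> times the \<open>j\<close>-th coordinate of \<open>q\<close> in the right singular basis. The space spanned by
the columns of \<open>Z\<close> contains a vector that has the same last block \<open>y\<close> as \<open>u\<close>, the same leading
coordinates, and for which the other coordinates of \<open>x\<close> are replaced by \<open>- b\<^sub>j / (d\<^sub>j\<^sup>2 - lam)\<close>: the
unknown shift \<open>t\<^sup>2\<close> is replaced by \<open>lam\<close>. The difference of the two is a coordinate of \<open>q\<close> times
\<open>d\<^sub>j (t\<^sup>2 - lam) / ((d\<^sub>j\<^sup>2 - t\<^sup>2) (d\<^sub>j\<^sup>2 - lam))\<close>, up to sign.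

Appending rows to a matrix cannot decrease its singular values (\<open>sing_val_append_rows\<close>), so
\<open>t > sigma\<close> for the first discarded singular value \<open>sigma\<close>, as the two are distinct. Hence every
discarded \<open>d\<^sub>j\<close> satisfies \<open>0 \<le> d\<^sub>j \<le> sigma < t\<close> and \<open>t\<^sup>2 \<le> lam\<close>, a range on which the factor above
increases with \<open>d\<^sub>j\<close> (\<open>filter_difference_mono\<close>). Its value at \<open>sigma\<close> therefore bounds the norm
of the difference (\<open>deflated_residual_bound\<close>), and the constant \<open>1\<close> suffices. The nearest point of the
range exists because the range is finitely generated (\<open>nearest_point_exists\<close>), and it is at least as
close as the vector just described.\<close>

section \<open>Adjoints\<close>

lemma dim_adjoint [simp]:
  "dim_row (mat_adjoint A) = dim_col A" "dim_col (mat_adjoint A) = dim_row A"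
  by (auto simp: mat_adjoint_def)

lemma adjoint_carrier [simp, intro]:
  "A \<in> carrier_mat m n \<Longrightarrow> mat_adjoint A \<in> carrier_mat n m"
  by (intro carrier_matI) auto

lemma mult_mat_vec_carrier_iff [simp]: "A *\<^sub>v v \<in> carrier_vec n \<longleftrightarrow> dim_row A = n"
  by (metis carrier_vecI carrier_vecD dim_mult_mat_vec)

lemma index_adjoint [simp]:
  fixes A :: "complex mat"
  assumes "i < dim_col A" "j < dim_row A"
  shows "mat_adjoint A $$ (i, j) = cnj (A $$ (j, i))"
  using assms by (simp add: mat_adjoint_def mat_of_rows_index)

lemma adjoint_adjoint [simp]:
  fixes A :: "complex mat"
  shows "mat_adjoint (mat_adjoint A) = A"
  by (rule eq_matI) auto

lemma adjoint_mult:
  fixes A B :: "complex mat"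
  assumes "A \<in> carrier_mat m n" "B \<in> carrier_mat n l"
  shows "mat_adjoint (A * B) = mat_adjoint B * mat_adjoint A"
  using assms by (intro eq_matI) (auto simp: scalar_prod_def mult.commute)

lemma adjoint_real_mat:
  "mat_adjoint (map_mat complex_of_real S) = map_mat complex_of_real S\<^sup>T"
  by (rule eq_matI) auto

lemma adjoint_sprod:
  fixes A :: "complex mat"
  assumes A: "A \<in> carrier_mat m n" and x: "x \<in> carrier_vec n" and y: "y \<in> carrier_vec m"
  shows "(A *\<^sub>v x) \<bullet>c y = x \<bullet>c (mat_adjoint A *\<^sub>v y)"
proof -
  have "(A *\<^sub>v x) \<bullet>c y = (\<Sum>i<m. \<Sum>j<n. A $$ (i, j) * x $ j * cnj (y $ i))"
    using A x y
    by (auto simp: scalar_prod_def row_def sum_distrib_right lessThan_atLeast0 intro!: sum.cong)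
  also have "\<dots> = (\<Sum>j<n. \<Sum>i<m. A $$ (i, j) * x $ j * cnj (y $ i))"
    by (rule sum.swap)
  also have "\<dots> = x \<bullet>c (mat_adjoint A *\<^sub>v y)"
    using A x y
    by (auto simp: scalar_prod_def row_def sum_distrib_left lessThan_atLeast0 algebra_simps
             intro!: sum.cong)
  finally show ?thesis .
qed

section \<open>The Euclidean norm and unitary matrices\<close>

lemma cvec_norm_nonneg [simp]: "0 \<le> cvec_norm v"
  by (simp add: cvec_norm_def)

lemma cvec_norm_sq: "(cvec_norm v)\<^sup>2 = (\<Sum>i<dim_vec v. (cmod (v $ i))\<^sup>2)"
  by (simp add: cvec_norm_def L2_set_def sum_nonneg)

lemma cvec_norm_eq_sprod: "complex_of_real ((cvec_norm v)\<^sup>2) = v \<bullet>c v"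
  by (simp add: cvec_norm_sq scalar_prod_def lessThan_atLeast0 complex_norm_square[symmetric]
           del: of_real_power)

lemma cvec_norm_append:
  "(cvec_norm (v @\<^sub>v w))\<^sup>2 = (cvec_norm v)\<^sup>2 + (cvec_norm w)\<^sup>2"
proof -
  have v: "v \<in> carrier_vec (dim_vec v)" and w: "w \<in> carrier_vec (dim_vec w)" by auto
  have c: "conjugate (v @\<^sub>v w) = conjugate v @\<^sub>v conjugate w"
    by (rule eq_vecI) auto
  have "complex_of_real ((cvec_norm (v @\<^sub>v w))\<^sup>2) = v \<bullet>c v + w \<bullet>c w"
    unfolding cvec_norm_eq_sprod c by (rule scalar_prod_append[OF v w]) auto
  then have "complex_of_real ((cvec_norm (v @\<^sub>v w))\<^sup>2)
      = complex_of_real ((cvec_norm v)\<^sup>2 + (cvec_norm w)\<^sup>2)"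
    unfolding of_real_add cvec_norm_eq_sprod .
  then show ?thesis by (simp only: of_real_eq_iff)
qed

lemma unitary_adjoint_cancel:
  assumes U: "unitary_mat n U" and v: "v \<in> carrier_vec n"
  shows "U *\<^sub>v (mat_adjoint U *\<^sub>v v) = v" "mat_adjoint U *\<^sub>v (U *\<^sub>v v) = v"
proof -
  have Uc: "U \<in> carrier_mat n n" and UU: "U * mat_adjoint U = 1\<^sub>m n" "mat_adjoint U * U = 1\<^sub>m n"
    using U by (auto simp: unitary_mat_def)
  show "U *\<^sub>v (mat_adjoint U *\<^sub>v v) = v"
    using assoc_mult_mat_vec[OF Uc adjoint_carrier[OF Uc] v] v by (simp add: UU)
  show "mat_adjoint U *\<^sub>v (U *\<^sub>v v) = v"
    using assoc_mult_mat_vec[OF adjoint_carrier[OF Uc] Uc v] v by (simp add: UU)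
qed

lemma cvec_norm_adjoint_unitary:
  assumes U: "unitary_mat n U" and v: "v \<in> carrier_vec n"
  shows "cvec_norm (mat_adjoint U *\<^sub>v v) = cvec_norm v"
proof -
  have Uc: "U \<in> carrier_mat n n"
    using U by (auto simp: unitary_mat_def)
  have "(mat_adjoint U *\<^sub>v v) \<bullet>c (mat_adjoint U *\<^sub>v v) = (U *\<^sub>v (mat_adjoint U *\<^sub>v v)) \<bullet>c v"
    using adjoint_sprod[OF Uc, of "mat_adjoint U *\<^sub>v v" v] Uc v by simp
  then have "complex_of_real ((cvec_norm (mat_adjoint U *\<^sub>v v))\<^sup>2)
      = complex_of_real ((cvec_norm v)\<^sup>2)"
    unfolding cvec_norm_eq_sprod unitary_adjoint_cancel(1)[OF U v] .
  then show ?thesis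
    by (simp only: of_real_eq_iff power2_eq_iff_nonneg cvec_norm_nonneg)
qed

lemma unitary_norm_coords:
  assumes "unitary_mat n U" "v \<in> carrier_vec n"
  shows "(cvec_norm v)\<^sup>2 = (\<Sum>j<n. (cmod ((mat_adjoint U *\<^sub>v v) $ j))\<^sup>2)"
proof -
  have "dim_col U = n" using assms(1) by (auto simp: unitary_mat_def)
  then show ?thesis
    unfolding cvec_norm_adjoint_unitary[OF assms, symmetric] cvec_norm_sq by simp
qed

lemma unitary_adjoint_col:
  assumes U: "unitary_mat n U" and j: "j < n"
  shows "mat_adjoint U *\<^sub>v col U j = unit_vec n j"
proof -
  have Uc: "U \<in> carrier_mat n n" and UU: "mat_adjoint U * U = 1\<^sub>m n"
    using U by (auto simp: unitary_mat_def)
  have "mat_adjoint U *\<^sub>v col U j = col (mat_adjoint U * U) j"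
    using Uc j by (subst col_mult2) auto
  then show ?thesis using j by (simp add: UU)
qed

section \<open>Singular value decompositions\<close>

lemma full_svdD:
  assumes "full_svd m n M U S V"
  shows "U \<in> carrier_mat m m" "V \<in> carrier_mat n n" "S \<in> carrier_mat m n"
    "M \<in> carrier_mat m n" "unitary_mat m U" "unitary_mat n V"
    "mat_adjoint U * U = 1\<^sub>m m" "mat_adjoint V * V = 1\<^sub>m n"
    "M = U * map_mat complex_of_real S * mat_adjoint V" "diagonal_mat S"
  using assms by (auto simp: full_svd_def unitary_mat_def)

lemma full_svd_nonneg: "full_svd m n M U S V \<Longrightarrow> 1 \<le> j \<Longrightarrow> j \<le> min m n \<Longrightarrow> 0 \<le> sing_val S j"
  by (auto simp: full_svd_def)

lemma full_svd_antimono: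
  "full_svd m n M U S V \<Longrightarrow> 1 \<le> i \<Longrightarrow> i \<le> j \<Longrightarrow> j \<le> min m n \<Longrightarrow> sing_val S j \<le> sing_val S i"
  by (auto simp: full_svd_def)

text \<open>Conjugating \<open>U \<Sigma> V\<^sup>H\<close> exchanges the two unitary factors and transposes the diagonal one. Every
fact about right singular vectors thus has a counterpart for left singular vectors.\<close>

lemma full_svd_adjoint:
  assumes "full_svd m n M U S V"
  shows "full_svd n m (mat_adjoint M) V S\<^sup>T U"
proof -
  note D = full_svdD[OF assms]
  let ?S = "map_mat complex_of_real S"
  have "mat_adjoint M = mat_adjoint (mat_adjoint V) * mat_adjoint (U * ?S)"
    unfolding D(9) by (rule adjoint_mult[of _ m n]) (use D in auto)
  also have "mat_adjoint (U * ?S) = mat_adjoint ?S * mat_adjoint U"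
    by (rule adjoint_mult) (use D in auto)
  finally have "mat_adjoint M = V * (map_mat complex_of_real S\<^sup>T * mat_adjoint U)"
    by (simp add: adjoint_real_mat)
  also have "\<dots> = V * map_mat complex_of_real S\<^sup>T * mat_adjoint U"
    by (rule assoc_mult_mat[symmetric]) (use D in auto)
  finally have M: "mat_adjoint M = \<dots>" .
  have idx: "sing_val S\<^sup>T j = sing_val S j" if "j \<in> {1..min n m}" for j
    using that D(3) by (auto simp: sing_val_def)
  have "diagonal_mat S\<^sup>T"
    using D(10) by (auto simp: diagonal_mat_def)
  then show ?thesis
    using assms M D(3) unfolding full_svd_def
    by (auto simp: idx)
qed

text \<open>In the two singular bases a matrix acts diagonally. Coordinates beyond the \<open>n\<close>-th meet only zero
rows of the diagonal factor.\<close>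

lemma svd_coords:
  assumes svd: "full_svd m n M U S V" and w: "w \<in> carrier_vec n" and j: "j < m"
  shows "(mat_adjoint U *\<^sub>v (M *\<^sub>v w)) $ j =
    (if j < n then complex_of_real (sing_val S (Suc j)) * (mat_adjoint V *\<^sub>v w) $ j else 0)"
proof -
  note D = full_svdD[OF svd]
  let ?S = "map_mat complex_of_real S"
  define h where "h = mat_adjoint V *\<^sub>v w"
  have h: "h \<in> carrier_vec n" using D w by (auto simp: h_def)
  have "M *\<^sub>v w = (U * ?S) *\<^sub>v h"
    unfolding D(9) h_def by (rule assoc_mult_mat_vec) (use D w in auto)
  also have "\<dots> = U *\<^sub>v (?S *\<^sub>v h)"
    by (rule assoc_mult_mat_vec) (use D h in auto)
  finally have "mat_adjoint U *\<^sub>v (M *\<^sub>v w) = (mat_adjoint U * U) *\<^sub>v (?S *\<^sub>v h)"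
    using assoc_mult_mat_vec[of "mat_adjoint U" m m U m "?S *\<^sub>v h"] D h by auto
  also have "\<dots> = ?S *\<^sub>v h" using D h by auto
  finally have "(mat_adjoint U *\<^sub>v (M *\<^sub>v w)) $ j = (\<Sum>l<n. of_real (S $$ (j, l)) * h $ l)"
    using D(3) h j by (auto simp: scalar_prod_def row_def lessThan_atLeast0 intro!: sum.cong)
  also have "\<dots> = (\<Sum>l<n. if l = j then of_real (sing_val S (Suc j)) * h $ j else 0)"
    using D(3,10) j by (intro sum.cong) (auto simp: diagonal_mat_def sing_val_def)
  also have "\<dots> = (if j < n then of_real (sing_val S (Suc j)) * h $ j else 0)"
    by simp
  finally show ?thesis by (simp add: h_def)
qed

lemma gram_coords:
  assumes svd: "full_svd m n B U S V" and x: "x \<in> carrier_vec m" and j: "j < m"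
  shows "(mat_adjoint U *\<^sub>v (B *\<^sub>v (mat_adjoint B *\<^sub>v x))) $ j =
    (if j < n then complex_of_real ((sing_val S (Suc j))\<^sup>2) else 0) * (mat_adjoint U *\<^sub>v x) $ j"
proof -
  note D = full_svdD[OF svd]
  have Bx: "mat_adjoint B *\<^sub>v x \<in> carrier_vec n" using D(4) by simp
  have "sing_val S\<^sup>T (Suc j) = sing_val S (Suc j)" if "j < n"
    using that j D(3) by (simp add: sing_val_def)
  then show ?thesis
    unfolding svd_coords[OF svd Bx j] using j
    by (simp add: svd_coords[OF full_svd_adjoint[OF svd] x] power2_eq_square)
qed

lemma sing_vec_carrier: "U \<in> carrier_mat m l \<Longrightarrow> sing_vec U j \<in> carrier_vec m"
  by (metis carrier_matD(1) carrier_vecI dim_col sing_vec_def)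

lemma svd_singular_vectors:
  assumes svd: "full_svd m n M U S V" and j: "1 \<le> j" "j \<le> min m n"
  shows "M *\<^sub>v sing_vec V j = complex_of_real (sing_val S j) \<cdot>\<^sub>v sing_vec U j"
proof -
  note D = full_svdD[OF svd]
  have vc: "sing_vec V j \<in> carrier_vec n" and uc: "sing_vec U j \<in> carrier_vec m"
    using D(1,2) by (auto intro: sing_vec_carrier)
  have eV: "mat_adjoint V *\<^sub>v sing_vec V j = unit_vec n (j - 1)"
    and eU: "mat_adjoint U *\<^sub>v sing_vec U j = unit_vec m (j - 1)"
    unfolding sing_vec_def using j
    by (auto intro!: unitary_adjoint_col[OF D(5)] unitary_adjoint_col[OF D(6)])
  have "mat_adjoint U *\<^sub>v (M *\<^sub>v sing_vec V j)
      = mat_adjoint U *\<^sub>v (complex_of_real (sing_val S j) \<cdot>\<^sub>v sing_vec U j)" (is "?l = ?r")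
  proof (rule eq_vecI)
    fix l assume "l < dim_vec ?r"
    then have l: "l < m" using D(1) by simp
    have "?r = complex_of_real (sing_val S j) \<cdot>\<^sub>v unit_vec m (j - 1)"
      unfolding eU[symmetric] by (rule mult_mat_vec[OF adjoint_carrier[OF D(1)] uc])
    moreover have "?l $ l = (if l = j - 1 then complex_of_real (sing_val S j) else 0)"
      unfolding svd_coords[OF svd vc l] eV using j l by auto
    ultimately show "?l $ l = ?r $ l"
      using j l by (simp add: unit_vec_def)
  qed simp
  then have "U *\<^sub>v ?l = U *\<^sub>v ?r" by (rule arg_cong)
  moreover have "U *\<^sub>v ?l = M *\<^sub>v sing_vec V j"
    by (rule unitary_adjoint_cancel(1)[OF D(5)]) (use D(4) in simp)
  moreover have "U *\<^sub>v ?r = complex_of_real (sing_val S j) \<cdot>\<^sub>v sing_vec U j"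
    by (rule unitary_adjoint_cancel(1)[OF D(5)]) (use uc in simp)
  ultimately show ?thesis by simp
qed

lemma svd_norm_sq:
  assumes svd: "full_svd m n M U S V" and w: "w \<in> carrier_vec n"
  shows "(cvec_norm (M *\<^sub>v w))\<^sup>2 =
    (\<Sum>j<min m n. (sing_val S (Suc j))\<^sup>2 * (cmod ((mat_adjoint V *\<^sub>v w) $ j))\<^sup>2)"
proof -
  note D = full_svdD[OF svd]
  have "(cvec_norm (M *\<^sub>v w))\<^sup>2 = (\<Sum>j<m. (cmod ((mat_adjoint U *\<^sub>v (M *\<^sub>v w)) $ j))\<^sup>2)"
    by (rule unitary_norm_coords[OF D(5)]) (use D(4) in simp)
  also have "\<dots> = (\<Sum>j<min m n. (cmod ((mat_adjoint U *\<^sub>v (M *\<^sub>v w)) $ j))\<^sup>2)"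
    by (rule sum.mono_neutral_right) (auto simp: svd_coords[OF svd w])
  also have "\<dots> = (\<Sum>j<min m n. (sing_val S (Suc j))\<^sup>2 * (cmod ((mat_adjoint V *\<^sub>v w) $ j))\<^sup>2)"
    by (intro sum.cong) (auto simp: svd_coords[OF svd w] norm_mult power_mult_distrib)
  finally show ?thesis .
qed

section \<open>Singular values under appended rows\<close>

text \<open>Padding the \<open>p\<close> equations in \<open>p + 1\<close> unknowns with a zero equation gives a square matrix of
determinant zero, hence one with a nonzero kernel vector.\<close>

lemma underdetermined_kernel:
  fixes g :: "nat \<Rightarrow> nat \<Rightarrow> complex"
  obtains c where "\<And>r. r < p \<Longrightarrow> (\<Sum>l<Suc p. g r l * c l) = 0"
    and "\<exists>l<Suc p. c l \<noteq> 0"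
proof -
  define G where "G = mat (Suc p) (Suc p) (\<lambda>(r, l). if r < p then g r l else 0)"
  have Gc: "G \<in> carrier_mat (Suc p) (Suc p)" by (simp add: G_def)
  have "G = mat\<^sub>r (Suc p) (Suc p) (\<lambda>i. if i = p then 0\<^sub>v (Suc p) else row G i)"
    by (rule eq_matI) (auto simp: G_def)
  moreover have "det \<dots> = 0"
    by (rule det_row_0) (auto simp: G_def)
  ultimately have "det G = 0" by simp
  then obtain v where v: "v \<in> carrier_vec (Suc p)" "v \<noteq> 0\<^sub>v (Suc p)" "G *\<^sub>v v = 0\<^sub>v (Suc p)"
    using det_0_iff_vec_prod_zero_field[OF Gc] by auto
  show thesis
  proof (rule that[of "\<lambda>l. v $ l"])
    fix r assume r: "r < p"
    have "(\<Sum>l<Suc p. g r l * v $ l) = (G *\<^sub>v v) $ r"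
      using r v(1) by (auto simp: G_def scalar_prod_def row_def lessThan_atLeast0 intro!: sum.cong)
    then show "(\<Sum>l<Suc p. g r l * v $ l) = 0" using v(3) r by simp
  next
    show "\<exists>l<Suc p. v $ l \<noteq> 0"
    proof (rule ccontr)
      assume "\<not> ?thesis"
      then have "v = 0\<^sub>v (Suc p)" using v(1) by (intro eq_vecI) auto
      then show False using v(2) by simp
    qed
  qed
qed

text \<open>The argument of Courant, Fischer and Weyl. The first \<open>i\<close> right singular vectors of \<open>B\<close> have a nonzero
combination \<open>w\<close> that is orthogonal to the first \<open>i - 1\<close> right singular vectors of the larger matrix. On
\<open>w\<close>, the matrix \<open>B\<close> expands by at least its \<open>i\<close>-th singular value and the larger matrix by at most its
own, while appended rows cannot shorten an image.\<close>

lemma sing_val_append_rows: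
  assumes B: "B \<in> carrier_mat m n" and E: "E \<in> carrier_mat s n"
    and svd: "full_svd m n B U S V" and svdh: "full_svd (m + s) n (B @\<^sub>r E) Uh Sh Vh"
    and i: "1 \<le> i" "i \<le> min m n"
  shows "sing_val S i \<le> sing_val Sh i"
proof -
  note D = full_svdD[OF svd] and Dh = full_svdD[OF svdh]
  define p where "p = i - 1"
  have ip: "i = Suc p" and pn: "p < n" "p < m" using i by (auto simp: p_def)
  define G where "G = mat_adjoint Vh * V"
  have Gc: "G \<in> carrier_mat n n" unfolding G_def using D(2) Dh(2) by (intro mult_carrier_mat) auto
  obtain c where c0: "\<And>r. r < p \<Longrightarrow> (\<Sum>l<Suc p. G $$ (r, l) * c l) = 0"
    and cne: "\<exists>l<Suc p. c l \<noteq> 0"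
    using underdetermined_kernel[of p "\<lambda>r l. G $$ (r, l)"] by metis
  \<comment> \<open>The combination \<open>w\<close> of the first \<open>i\<close> right singular vectors has coefficients \<open>c\<close>, padded with zeros.\<close>
  define c' where "c' = vec n (\<lambda>l. if l < Suc p then c l else 0)"
  define w where "w = V *\<^sub>v c'"
  have c'c: "c' \<in> carrier_vec n" by (simp add: c'_def)
  have wc: "w \<in> carrier_vec n" unfolding w_def using D(2) by simp
  have Vw: "mat_adjoint V *\<^sub>v w = c'"
    unfolding w_def by (rule unitary_adjoint_cancel(2)[OF D(6) c'c])
  have Vhw: "(mat_adjoint Vh *\<^sub>v w) $ r = 0" if r: "r < p" for r
  proof -
    have "mat_adjoint Vh *\<^sub>v w = G *\<^sub>v c'"
      unfolding w_def G_def by (rule assoc_mult_mat_vec[symmetric, OF adjoint_carrier[OF Dh(2)] D(2) c'c])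
    then have "(mat_adjoint Vh *\<^sub>v w) $ r = (\<Sum>l<n. G $$ (r, l) * (if l < Suc p then c l else 0))"
      using Gc r pn by (simp add: scalar_prod_def row_def c'_def lessThan_atLeast0)
    also have "\<dots> = (\<Sum>l<Suc p. G $$ (r, l) * c l)"
      using pn by (intro sum.mono_neutral_cong_right) auto
    finally show ?thesis using c0[OF r] by simp
  qed
  define N where "N = (\<Sum>l<Suc p. (cmod (c l))\<^sup>2)"
  have Npos: "0 < N"
  proof -
    obtain l where "l < Suc p" "c l \<noteq> 0" using cne by blast
    then show ?thesis unfolding N_def by (intro sum_pos2[of _ l]) auto
  qed
  have wN: "(cvec_norm w)\<^sup>2 = N"
    unfolding unitary_norm_coords[OF D(6) wc] Vw N_def
    using pn by (intro sum.mono_neutral_cong_right) (auto simp: c'_def)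
  have "(sing_val S i)\<^sup>2 * N = (\<Sum>j<Suc p. (sing_val S i)\<^sup>2 * (cmod (c j))\<^sup>2)"
    by (simp only: N_def sum_distrib_left)
  also have "\<dots> \<le> (\<Sum>j<Suc p. (sing_val S (Suc j))\<^sup>2 * (cmod (c j))\<^sup>2)"
    using i by (intro sum_mono mult_right_mono power_mono full_svd_antimono[OF svd]
        full_svd_nonneg[OF svd]) (auto simp: ip)
  also have "\<dots> = (\<Sum>j<min m n. (sing_val S (Suc j))\<^sup>2 * (cmod (c' $ j))\<^sup>2)"
    using pn by (intro sum.mono_neutral_cong_left) (auto simp: c'_def)
  also have "\<dots> = (cvec_norm (B *\<^sub>v w))\<^sup>2"
    unfolding svd_norm_sq[OF svd wc] Vw ..
  also have "\<dots> \<le> (cvec_norm ((B @\<^sub>r E) *\<^sub>v w))\<^sup>2"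
    unfolding mat_mult_append[OF B E wc] cvec_norm_append by simp
  also have "\<dots> = (\<Sum>j<min (m + s) n. (sing_val Sh (Suc j))\<^sup>2 * (cmod ((mat_adjoint Vh *\<^sub>v w) $ j))\<^sup>2)"
    by (rule svd_norm_sq[OF svdh wc])
  also have "\<dots> \<le> (\<Sum>j<min (m + s) n. (sing_val Sh i)\<^sup>2 * (cmod ((mat_adjoint Vh *\<^sub>v w) $ j))\<^sup>2)"
  proof (rule sum_mono)
    fix j assume j: "j \<in> {..<min (m + s) n}"
    show "(sing_val Sh (Suc j))\<^sup>2 * (cmod ((mat_adjoint Vh *\<^sub>v w) $ j))\<^sup>2
      \<le> (sing_val Sh i)\<^sup>2 * (cmod ((mat_adjoint Vh *\<^sub>v w) $ j))\<^sup>2"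
    proof (cases "j < p")
      case True
      then show ?thesis by (simp add: Vhw)
    next
      case False
      then show ?thesis using i j
        by (intro mult_right_mono power_mono full_svd_antimono[OF svdh] full_svd_nonneg[OF svdh])
          (auto simp: ip)
    qed
  qed
  also have "\<dots> \<le> (\<Sum>j<n. (sing_val Sh i)\<^sup>2 * (cmod ((mat_adjoint Vh *\<^sub>v w) $ j))\<^sup>2)"
    by (rule sum_mono2) auto
  also have "\<dots> = (sing_val Sh i)\<^sup>2 * (cvec_norm w)\<^sup>2"
    unfolding unitary_norm_coords[OF Dh(6) wc] by (simp only: sum_distrib_left)
  finally have "(sing_val S i)\<^sup>2 \<le> (sing_val Sh i)\<^sup>2"
    using Npos by (simp add: wN)
  then show ?thesis
    by (rule power2_le_imp_le) (rule full_svd_nonneg[OF svdh], use i in auto)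
qed

section \<open>Nearest points in a column space\<close>

lemma sprod_span_zero:
  fixes r :: "complex vec"
  assumes vs: "set vs \<subseteq> carrier_vec n" and r: "r \<in> carrier_vec n"
    and orth: "\<And>v. v \<in> set vs \<Longrightarrow> r \<bullet>c v = 0"
    and w: "w \<in> module.span class_ring (module_vec TYPE(complex) n) (set vs)"
  shows "r \<bullet>c w = 0"
proof -
  interpret vec_space "TYPE(complex)" n .
  let ?A = "mat_of_cols n vs"
  have A: "?A \<in> carrier_mat n (length vs)" by simp
  have "w \<in> col_space ?A" using w vs by (simp add: col_space_def)
  then obtain x where x: "x \<in> carrier_vec (length vs)" and wx: "w = ?A *\<^sub>v x"
    unfolding col_space_eq[OF A] by auto
  have adj: "mat_adjoint ?A *\<^sub>v r = 0\<^sub>v (length vs)"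
  proof (rule eq_vecI)
    fix j assume "j < dim_vec (0\<^sub>v (length vs) :: complex vec)"
    then have j: "j < length vs" by simp
    then have v: "vs ! j \<in> carrier_vec n" using vs by auto
    have "row (mat_adjoint ?A) j = conjugate (vs ! j)"
      using j v by (intro eq_vecI) (auto simp: mat_of_cols_index)
    moreover have "conjugate (vs ! j) \<bullet> r = r \<bullet>c (vs ! j)"
      by (rule conjugate_vec_sprod_comm[OF r v, symmetric])
    ultimately show "(mat_adjoint ?A *\<^sub>v r) $ j = 0\<^sub>v (length vs) $ j"
      using j orth[of "vs ! j"] by simp
  qed simp
  have "r \<bullet>c (?A *\<^sub>v x) = (mat_adjoint ?A *\<^sub>v r) \<bullet>c x"
    using adjoint_sprod[OF adjoint_carrier[OF A] r x] by simp
  also have "\<dots> = 0" unfolding adj using x by simp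
  finally show ?thesis by (simp add: wx)
qed

text \<open>Gram--Schmidt by induction on the generators. For a new generator \<open>v\<close>, subtract from it its projection
onto the span of the others; the remainder \<open>e\<close> gives one more orthogonal direction, and the component
of \<open>u - p\<close> along \<open>e\<close> is all that is left to remove.\<close>

lemma orthogonal_projection_span:
  assumes vs: "set vs \<subseteq> carrier_vec n" and u: "u \<in> carrier_vec n"
  shows "\<exists>p \<in> module.span class_ring (module_vec TYPE(complex) n) (set vs).
    \<forall>v \<in> set vs. (u - p) \<bullet>c v = 0"
  using assms
proof (induction vs arbitrary: u)
  case Nil
  interpret vec_space "TYPE(complex)" n .
  show ?case using span_zero by auto
next
  case (Cons v vs)
  interpret vec_space "TYPE(complex)" n .
  have vc: "v \<in> carrier_vec n" and vs: "set vs \<subseteq> carrier_vec n" using Cons.prems by auto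
  have spc: "x \<in> carrier_vec n" if "x \<in> span (set vs)" for x
    using span_is_subset2[of "set vs"] vs that by auto
  have mono: "x \<in> span (set (v # vs))" if "x \<in> span (set vs)" for x
    using span_is_monotone[of "set vs" "set (v # vs)"] that by auto
  have v_in: "v \<in> span (set (v # vs))"
    using span_mem[of "set (v # vs)" v] Cons.prems by auto
  obtain p where p: "p \<in> span (set vs)" and po: "\<forall>x \<in> set vs. (u - p) \<bullet>c x = 0"
    using Cons.IH[OF vs Cons.prems(2)] by auto
  obtain q where q: "q \<in> span (set vs)" and qo: "\<forall>x \<in> set vs. (v - q) \<bullet>c x = 0"
    using Cons.IH[OF vs vc] by auto
  have pc: "p \<in> carrier_vec n" and qc: "q \<in> carrier_vec n" using p q spc by auto
  define e where "e = v - q"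
  have ec: "e \<in> carrier_vec n" using vc qc by (simp add: e_def)
  have upc: "u - p \<in> carrier_vec n" using Cons.prems pc by simp
  have v_eq: "v = e + q" using vc qc by (intro eq_vecI) (auto simp: e_def)
  have sprod_v: "r \<bullet>c v = r \<bullet>c e + r \<bullet>c q" if "r \<in> carrier_vec n" for r
    unfolding v_eq conjugate_add_vec[OF ec qc]
    by (rule scalar_prod_add_distrib) (use that ec qc in auto)
  have "(u - p) \<bullet>c q = 0" and eq0: "e \<bullet>c q = 0"
    using sprod_span_zero[OF vs upc _ q] sprod_span_zero[OF vs ec _ q] po qo
    by (auto simp: e_def)
  then have upv: "(u - p) \<bullet>c v = (u - p) \<bullet>c e" and ev: "e \<bullet>c v = e \<bullet>c e"
    using sprod_v[OF upc] sprod_v[OF ec] by auto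
  \<comment> \<open>If \<open>e = 0\<close>, the quotient is \<open>0\<close> and no correction is made.\<close>
  define a where "a = ((u - p) \<bullet>c e) / (e \<bullet>c e)"
  define p' where "p' = p + a \<cdot>\<^sub>v e"
  have a: "(u - p) \<bullet>c e = a * (e \<bullet>c e)"
  proof (cases "e \<bullet>c e = 0")
    case True
    then have "e = 0\<^sub>v n" using conjugate_square_eq_0_vec[OF ec] by simp
    then show ?thesis using upc by (simp add: True)
  qed (simp add: a_def)
  have "e = v + (- 1) \<cdot>\<^sub>v q" using vc qc by (intro eq_vecI) (auto simp: e_def)
  then have "e \<in> span (set (v # vs))"
    using span_add1[OF _ v_in smult_in_span[OF _ mono[OF q], of "- 1"]] Cons.prems by auto
  then have p'_in: "p' \<in> span (set (v # vs))"
    unfolding p'_def using span_add1[OF _ mono[OF p] smult_in_span, of e a] Cons.prems by auto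
  have "(u - p') \<bullet>c x = 0" if x: "x \<in> set (v # vs)" for x
  proof -
    have xc: "x \<in> carrier_vec n" using x Cons.prems by auto
    have "u - p' = (u - p) - a \<cdot>\<^sub>v e"
      using Cons.prems pc ec by (intro eq_vecI) (auto simp: p'_def)
    then have "(u - p') \<bullet>c x = (u - p) \<bullet>c x - a * (e \<bullet>c x)"
      using upc ec xc by (simp add: minus_scalar_prod_distrib[of _ n])
    then show ?thesis
      using x po qo upv ev a by (auto simp: e_def)
  qed
  then show ?case using p'_in by blast
qed

text \<open>By the theorem of Pythagoras, the orthogonal projection is a nearest point.\<close>

lemma nearest_point_exists:
  assumes A: "A \<in> carrier_mat n l" and u: "u \<in> carrier_vec n"
  shows "\<exists>p. is_arg_min (\<lambda>z. cvec_norm (u - z)) (\<lambda>z. z \<in> mat_range A) p"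
proof -
  interpret vec_space "TYPE(complex)" n .
  have cols: "set (cols A) \<subseteq> carrier_vec n" using A cols_dim by blast
  have range: "mat_range A = span (set (cols A))"
    using A by (simp add: mat_range_def col_space_def)
  obtain p where p: "p \<in> span (set (cols A))" and po: "\<forall>v \<in> set (cols A). (u - p) \<bullet>c v = 0"
    using orthogonal_projection_span[OF cols u] by auto
  have spc: "x \<in> carrier_vec n" if "x \<in> span (set (cols A))" for x
    using span_is_subset2[of "set (cols A)"] cols that by auto
  have pc: "p \<in> carrier_vec n" using spc p .
  have "cvec_norm (u - p) \<le> cvec_norm (u - z)" if z: "z \<in> span (set (cols A))" for z
  proof -
    have zc: "z \<in> carrier_vec n" using spc z .
    let ?r = "u - p" and ?d = "p - z"
    have rc: "?r \<in> carrier_vec n" and dc: "?d \<in> carrier_vec n" using u pc zc by auto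
    have "?d = p + (- 1) \<cdot>\<^sub>v z" using pc zc by (intro eq_vecI) auto
    then have d: "?d \<in> span (set (cols A))"
      using span_add1[OF cols p smult_in_span[OF cols z, of "- 1"]] by simp
    have rd: "?r \<bullet>c ?d = 0" using sprod_span_zero[OF cols rc _ d] po by blast
    have "cnj (?r \<bullet>c ?d) = conjugate ?r \<bullet> ?d"
      using conjugate_sprod_vec[of ?r n "conjugate ?d"] rc dc by simp
    then have dr: "?d \<bullet>c ?r = 0"
      using rd conjugate_vec_sprod_comm[OF dc rc] by simp
    have uz: "u - z = ?r + ?d" using u pc zc by (intro eq_vecI) auto
    have "(u - z) \<bullet>c (u - z) = ?r \<bullet>c ?r + ?d \<bullet>c ?d"
      unfolding uz conjugate_add_vec[OF rc dc]
      using rc dc rd dr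
      by (simp add: add_scalar_prod_distrib[of _ n] scalar_prod_add_distrib[of _ n])
    then have "complex_of_real ((cvec_norm (u - z))\<^sup>2)
        = complex_of_real ((cvec_norm ?r)\<^sup>2 + (cvec_norm ?d)\<^sup>2)"
      unfolding of_real_add cvec_norm_eq_sprod .
    then have "(cvec_norm (u - z))\<^sup>2 = (cvec_norm ?r)\<^sup>2 + (cvec_norm ?d)\<^sup>2"
      by (simp only: of_real_eq_iff)
    then have "(cvec_norm ?r)\<^sup>2 \<le> (cvec_norm (u - z))\<^sup>2" by simp
    then show ?thesis by (rule power2_le_imp_le) simp
  qed
  then show ?thesis using p unfolding range is_arg_min_linorder by blast
qed

section \<open>Block matrices and leading columns\<close>

lemma append_cols_mult_vec:
  assumes M: "M \<in> carrier_mat a b" and N: "N \<in> carrier_mat a c"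
    and x: "x \<in> carrier_vec b" and y: "y \<in> carrier_vec c"
  shows "append_cols M N *\<^sub>v (x @\<^sub>v y) = M *\<^sub>v x + N *\<^sub>v y"
proof -
  have "append_cols M N *\<^sub>v (x @\<^sub>v y)
      = (M *\<^sub>v x + N *\<^sub>v y) @\<^sub>v (0\<^sub>m 0 b *\<^sub>v x + 0\<^sub>m 0 c *\<^sub>v y)"
    unfolding append_cols_def carrier_matD(2)[OF M] carrier_matD(2)[OF N]
    by (rule four_block_mat_mult_vec[OF M N _ _ x y]) auto
  also have "\<dots> = M *\<^sub>v x + N *\<^sub>v y"
    using M N by (intro eq_vecI) auto
  finally show ?thesis .
qed

lemma append_cols_carrier:
  "M \<in> carrier_mat a b \<Longrightarrow> N \<in> carrier_mat a c \<Longrightarrow> append_cols M N \<in> carrier_mat a (b + c)"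
  by (intro carrier_matI) (auto simp: append_cols_def)

lemma adjoint_append_rows:
  fixes B E :: "complex mat"
  assumes B: "B \<in> carrier_mat m n" and E: "E \<in> carrier_mat s n"
  shows "mat_adjoint (B @\<^sub>r E) = append_cols (mat_adjoint B) (mat_adjoint E)"
  using B E by (intro eq_matI) (auto simp: append_rows_def append_cols_def)

lemma leading_cols_carrier:
  "U \<in> carrier_mat m l \<Longrightarrow> leading_cols k U \<in> carrier_mat m k"
  by (intro carrier_matI) (auto simp: leading_cols_def)

lemma leading_cols_index:
  "i < dim_row U \<Longrightarrow> j < k \<Longrightarrow> j < dim_col U \<Longrightarrow> leading_cols k U $$ (i, j) = U $$ (i, j)"
  by (simp add: leading_cols_def mat_of_cols_index sing_vec_def del: upt_Suc)

lemma complement_projector_carrier: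
  assumes "U \<in> carrier_mat m l"
  shows "1\<^sub>m m - leading_cols k U * mat_adjoint (leading_cols k U) \<in> carrier_mat m m"
  by (intro minus_carrier_mat mult_carrier_mat[of _ m k] adjoint_carrier leading_cols_carrier[OF assms])

text \<open>\<open>I - U\<^sub>k U\<^sub>k\<^sup>H\<close> erases the first \<open>k\<close> coordinates in the basis of the columns of \<open>U\<close> and keeps the
others.\<close>

lemma leading_projector_coords:
  assumes U: "unitary_mat m U" and k: "k \<le> m" and w: "w \<in> carrier_vec m" and j: "j < m"
  shows "(mat_adjoint U *\<^sub>v ((1\<^sub>m m - leading_cols k U * mat_adjoint (leading_cols k U)) *\<^sub>v w)) $ j =
    (if j < k then 0 else (mat_adjoint U *\<^sub>v w) $ j)"
proof -
  let ?L = "leading_cols k U"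
  have Uc: "U \<in> carrier_mat m m" using U by (auto simp: unitary_mat_def)
  have L: "?L \<in> carrier_mat m k" by (rule leading_cols_carrier[OF Uc])
  have La: "mat_adjoint ?L \<in> carrier_mat k m" by (rule adjoint_carrier[OF L])
  have Ua: "mat_adjoint U \<in> carrier_mat m m" by (rule adjoint_carrier[OF Uc])
  define t where "t = vec m (\<lambda>l. if l < k then (mat_adjoint U *\<^sub>v w) $ l else 0)"
  have t: "t \<in> carrier_vec m" by (simp add: t_def)
  have Law: "(mat_adjoint ?L *\<^sub>v w) $ l = t $ l" if "l < k" for l
    using that L Uc k w
    by (auto simp: t_def scalar_prod_def row_def leading_cols_index intro!: sum.cong)
  have proj: "(?L * mat_adjoint ?L) *\<^sub>v w = U *\<^sub>v t"
  proof -
    have "?L *\<^sub>v (mat_adjoint ?L *\<^sub>v w) = U *\<^sub>v t"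
    proof (rule eq_vecI)
      fix r assume "r < dim_vec (U *\<^sub>v t)"
      then have r: "r < m" using Uc by simp
      have "(?L *\<^sub>v (mat_adjoint ?L *\<^sub>v w)) $ r = (\<Sum>l<k. ?L $$ (r, l) * (mat_adjoint ?L *\<^sub>v w) $ l)"
        using L r by (simp add: scalar_prod_def row_def lessThan_atLeast0)
      also have "\<dots> = (\<Sum>l<k. U $$ (r, l) * t $ l)"
        using Uc r k by (intro sum.cong) (auto simp: Law leading_cols_index)
      also have "\<dots> = (\<Sum>l<m. U $$ (r, l) * t $ l)"
        using k by (intro sum.mono_neutral_left) (auto simp: t_def)
      also have "\<dots> = (U *\<^sub>v t) $ r"
        using Uc r t by (simp add: scalar_prod_def row_def lessThan_atLeast0)
      finally show "(?L *\<^sub>v (mat_adjoint ?L *\<^sub>v w)) $ r = (U *\<^sub>v t) $ r" .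
    qed (use L Uc in simp)
    then show ?thesis by (simp add: assoc_mult_mat_vec[OF L La w])
  qed
  have "(1\<^sub>m m - ?L * mat_adjoint ?L) *\<^sub>v w = w - U *\<^sub>v t"
    using minus_mult_distrib_mat_vec[OF one_carrier_mat mult_carrier_mat[OF L La] w] w
    by (simp add: proj)
  then have "mat_adjoint U *\<^sub>v ((1\<^sub>m m - ?L * mat_adjoint ?L) *\<^sub>v w)
      = mat_adjoint U *\<^sub>v w - mat_adjoint U *\<^sub>v (U *\<^sub>v t)"
    using mult_minus_distrib_mat_vec[OF Ua w, of "U *\<^sub>v t"] Uc by simp
  then show ?thesis
    using j t Uc by (simp add: unitary_adjoint_cancel(2)[OF U t]) (simp add: t_def)
qed

section \<open>The singular vector equation and the resolvent\<close>

text \<open>The first block row of \<open>A A\<^sup>H u = t\<^sup>2 u\<close>. It is obtained from \<open>A v = t u\<close> and \<open>A\<^sup>H u = t v\<close>, so the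
product \<open>A A\<^sup>H\<close> itself need not be split into blocks.\<close>

lemma gram_left_singular_vector:
  assumes B: "B \<in> carrier_mat m n" and E: "E \<in> carrier_mat s n"
    and svdh: "full_svd (m + s) n (B @\<^sub>r E) Uh Sh Vh"
    and i: "1 \<le> i" "i \<le> min (m + s) n"
  defines "x \<equiv> vec_first (sing_vec Uh i) m" and "y \<equiv> vec_last (sing_vec Uh i) s"
  shows "B *\<^sub>v (mat_adjoint B *\<^sub>v x) + B *\<^sub>v (mat_adjoint E *\<^sub>v y)
    = complex_of_real ((sing_val Sh i)\<^sup>2) \<cdot>\<^sub>v x"
proof -
  note Dh = full_svdD[OF svdh]
  define u v t where "u = sing_vec Uh i" and "v = sing_vec Vh i" and "t = complex_of_real (sing_val Sh i)"
  have uc: "u \<in> carrier_vec (m + s)" and vc: "v \<in> carrier_vec n"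
    unfolding u_def v_def using Dh(1,2) by (auto intro: sing_vec_carrier)
  have x: "x \<in> carrier_vec m" and y: "y \<in> carrier_vec s" by (simp_all add: x_def y_def)
  have u: "u = x @\<^sub>v y" using uc by (simp add: x_def y_def u_def[symmetric])
  have "B *\<^sub>v v @\<^sub>v E *\<^sub>v v = t \<cdot>\<^sub>v u"
    using svd_singular_vectors[OF svdh i] mat_mult_append[OF B E vc]
    by (simp add: u_def v_def t_def)
  also have "\<dots> = t \<cdot>\<^sub>v x @\<^sub>v t \<cdot>\<^sub>v y"
    unfolding u by (rule eq_vecI) auto
  finally have Bv: "B *\<^sub>v v = t \<cdot>\<^sub>v x"
    by (subst (asm) append_vec_eq[of _ m]) (use B x in auto)
  have "sing_val Sh\<^sup>T i = sing_val Sh i"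
    using i Dh(3) by (auto simp: sing_val_def)
  then have "mat_adjoint (B @\<^sub>r E) *\<^sub>v u = t \<cdot>\<^sub>v v"
    using svd_singular_vectors[OF full_svd_adjoint[OF svdh], of i] i by (simp add: u_def v_def t_def)
  then have Au: "mat_adjoint B *\<^sub>v x + mat_adjoint E *\<^sub>v y = t \<cdot>\<^sub>v v"
    unfolding adjoint_append_rows[OF B E] u
      append_cols_mult_vec[OF adjoint_carrier[OF B] adjoint_carrier[OF E] x y] .
  have "B *\<^sub>v (mat_adjoint B *\<^sub>v x) + B *\<^sub>v (mat_adjoint E *\<^sub>v y)
      = B *\<^sub>v (mat_adjoint B *\<^sub>v x + mat_adjoint E *\<^sub>v y)"
    by (rule mult_add_distrib_mat_vec[OF B, symmetric]) (use B E in auto)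
  also have "\<dots> = t \<cdot>\<^sub>v (B *\<^sub>v v)"
    unfolding Au by (rule mult_mat_vec[OF B vc])
  also have "\<dots> = complex_of_real ((sing_val Sh i)\<^sup>2) \<cdot>\<^sub>v x"
    unfolding Bv by (simp add: smult_smult_assoc t_def power2_eq_square)
  finally show ?thesis .
qed

lemma mat_inverse_invertible:
  fixes A :: "complex mat"
  assumes A: "A \<in> carrier_mat m m" and inv: "invertible_mat A"
  shows "the (mat_inverse A) \<in> carrier_mat m m" "A * the (mat_inverse A) = 1\<^sub>m m"
proof -
  obtain X where X: "A * X = 1\<^sub>m m" "X * A = 1\<^sub>m (dim_row X)"
    using inv A by (auto simp: invertible_mat_def inverts_mat_def)
  have "dim_col X = m" using arg_cong[OF X(1), of dim_col] by simp
  moreover have "dim_row X = m" using arg_cong[OF X(2), of dim_col] A by simp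
  ultimately have Xc: "X \<in> carrier_mat m m" by auto
  have "A \<in> Units (ring_mat TYPE(complex) m ())"
    unfolding Units_def ring_mat_def using A X Xc by auto
  then obtain Y where "mat_inverse A = Some Y"
    using mat_inverse(1)[OF A, of "()"] by (cases "mat_inverse A") auto
  then show "the (mat_inverse A) \<in> carrier_mat m m" "A * the (mat_inverse A) = 1\<^sub>m m"
    using mat_inverse(2)[OF A] by auto
qed

lemma shifted_gram_carrier: "B \<in> carrier_mat m n \<Longrightarrow> shifted_gram B lam \<in> carrier_mat m m"
  by (auto simp: shifted_gram_def)

lemma shifted_gram_mult_vec:
  assumes B: "B \<in> carrier_mat m n" and g: "g \<in> carrier_vec m"
  shows "shifted_gram B lam *\<^sub>v g = B *\<^sub>v (mat_adjoint B *\<^sub>v g) - complex_of_real lam \<cdot>\<^sub>v g"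
proof -
  have Ba: "mat_adjoint B \<in> carrier_mat n m" using B by (rule adjoint_carrier)
  have dr: "dim_row B = m" using B by simp
  have "(complex_of_real lam \<cdot>\<^sub>m 1\<^sub>m m) *\<^sub>v g = complex_of_real lam \<cdot>\<^sub>v g"
    using g by (intro eq_vecI) (auto simp: scalar_prod_smult_left)
  then show ?thesis
    unfolding shifted_gram_def dr
    using minus_mult_distrib_mat_vec[OF mult_carrier_mat[OF B Ba] _ g, of "complex_of_real lam \<cdot>\<^sub>m 1\<^sub>m m"]
    by (simp add: assoc_mult_mat_vec[OF B Ba g])
qed

text \<open>One coordinate of the residual: \<open>X\<close> solves the eigenvector equation with shift \<open>a\<close>, and \<open>- g\<close> solves
the same equation with \<open>a\<close> replaced by \<open>l\<close>. Their difference carries the factor \<open>a - l\<close>.\<close>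

lemma resolvent_difference:
  fixes X g b e a l :: complex
  assumes "e * X + b = a * X" "e * g - l * g = b" "e \<noteq> a" "e \<noteq> l"
  shows "X + g = - (b * (a - l) / ((e - a) * (e - l)))"
proof -
  have "(e - a) * X = - b" "(e - l) * g = b" using assms by (auto simp: algebra_simps eq_neg_iff_add_eq_0)
  then have X: "X = - b / (e - a)" and g: "g = b / (e - l)"
    using assms(3,4) by (simp_all add: eq_divide_eq mult.commute del: minus_divide_left[symmetric] divide_minus_left)
  have "X + g = (- b * (e - l) + b * (e - a)) / ((e - a) * (e - l))"
    unfolding X g by (rule add_frac_eq) (use assms(3,4) in simp_all)
  also have "- b * (e - l) + b * (e - a) = - (b * (a - l))"
    by (simp add: algebra_simps)
  finally show ?thesis by simp
qed

text \<open>On \<open>0 \<le> d < t\<close> the numerator grows with \<open>d\<close>, whereas both factors of the denominator decrease in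
absolute value.\<close>

lemma filter_difference_mono:
  fixes d :: real
  assumes "0 \<le> d" "d \<le> s" "s < t" "t\<^sup>2 \<le> lam"
  shows "\<bar>d * (t\<^sup>2 - lam) / ((d\<^sup>2 - t\<^sup>2) * (d\<^sup>2 - lam))\<bar>
    \<le> \<bar>s * (t\<^sup>2 - lam) / ((s\<^sup>2 - t\<^sup>2) * (s\<^sup>2 - lam))\<bar>"
proof -
  have d2: "d\<^sup>2 \<le> s\<^sup>2" using assms by (intro power_mono) auto
  have s2: "s\<^sup>2 < t\<^sup>2" using assms by (intro power_strict_mono) auto
  have pos: "0 < (t\<^sup>2 - s\<^sup>2) * (lam - s\<^sup>2)" using s2 assms by (intro mult_pos_pos) auto
  have le: "(t\<^sup>2 - s\<^sup>2) * (lam - s\<^sup>2) \<le> (t\<^sup>2 - d\<^sup>2) * (lam - d\<^sup>2)"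
    using d2 s2 assms by (intro mult_mono) auto
  have abs: "\<bar>c * (t\<^sup>2 - lam) / ((c\<^sup>2 - t\<^sup>2) * (c\<^sup>2 - lam))\<bar>
      = c * (lam - t\<^sup>2) / ((t\<^sup>2 - c\<^sup>2) * (lam - c\<^sup>2))" if "0 \<le> c" "c\<^sup>2 < t\<^sup>2" for c
    using that assms by (simp add: abs_mult abs_of_neg abs_of_nonpos)
  have "d * (lam - t\<^sup>2) / ((t\<^sup>2 - d\<^sup>2) * (lam - d\<^sup>2))
      \<le> s * (lam - t\<^sup>2) / ((t\<^sup>2 - s\<^sup>2) * (lam - s\<^sup>2))"
    using assms by (intro frac_le[OF _ _ pos le] mult_right_mono) auto
  then show ?thesis using abs[of d] abs[of s] assms d2 s2 by auto
qed

text \<open>The vector whose norm is bounded is the error of the approximation by the augmented space, when \<open>x\<close> is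
the upper block of a singular vector. Its coordinates in the basis \<open>U\<close> are bounded one
at a time by those of \<open>q\<close> in the basis \<open>V\<close>; since both bases are orthonormal, the bounds add up to a bound
for norms.\<close>

lemma deflated_residual_bound:
  assumes B: "B \<in> carrier_mat m n" and svd: "full_svd m n B U S V"
    and k: "k < min m n"
    and x: "x \<in> carrier_vec m" and g: "g \<in> carrier_vec m" and q: "q \<in> carrier_vec n"
    and eigen: "B *\<^sub>v (mat_adjoint B *\<^sub>v x) + B *\<^sub>v q = complex_of_real (t\<^sup>2) \<cdot>\<^sub>v x"
    and resolvent: "shifted_gram B lam *\<^sub>v g = B *\<^sub>v q"
    and t: "sing_val S (k + 1) < t" and lam: "t\<^sup>2 \<le> lam"
  defines "sigma \<equiv> sing_val S (k + 1)"
  shows "cvec_norm ((1\<^sub>m m - leading_cols k U * mat_adjoint (leading_cols k U)) *\<^sub>v (x + g))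
    \<le> \<bar>sigma * (t\<^sup>2 - lam) / ((sigma\<^sup>2 - t\<^sup>2) * (sigma\<^sup>2 - lam))\<bar> * cvec_norm q"
proof -
  note D = full_svdD[OF svd]
  have Ua: "mat_adjoint U \<in> carrier_mat m m" by (rule adjoint_carrier[OF D(1)])
  define h where "h = mat_adjoint V *\<^sub>v q"
  define K where "K = \<bar>sigma * (t\<^sup>2 - lam) / ((sigma\<^sup>2 - t\<^sup>2) * (sigma\<^sup>2 - lam))\<bar>"
  define r where "r = (1\<^sub>m m - leading_cols k U * mat_adjoint (leading_cols k U)) *\<^sub>v (x + g)"
  define d where "d = (\<lambda>j. if j < n then sing_val S (Suc j) else 0)"
  have xg: "x + g \<in> carrier_vec m" using x g by simp
  have rc: "r \<in> carrier_vec m"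
    unfolding r_def by (rule mult_mat_vec_carrier[OF complement_projector_carrier[OF D(1)] xg])
  have gram: "(mat_adjoint U *\<^sub>v (B *\<^sub>v (mat_adjoint B *\<^sub>v w))) $ j
      = complex_of_real ((d j)\<^sup>2) * (mat_adjoint U *\<^sub>v w) $ j"
    if "w \<in> carrier_vec m" "j < m" for w j
    using gram_coords[OF svd that] by (simp add: d_def)
  have Bq: "(mat_adjoint U *\<^sub>v (B *\<^sub>v q)) $ j = complex_of_real (d j) * (if j < n then h $ j else 0)"
    if "j < m" for j
    using svd_coords[OF svd q that] by (simp add: d_def h_def)
  have Bc: "B *\<^sub>v z \<in> carrier_vec m" for z using B by simp
  have coord: "cmod ((mat_adjoint U *\<^sub>v r) $ j) \<le> K * (if j < n then cmod (h $ j) else 0)"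
    if j: "j < m" for j
  proof (cases "j < k")
    case True
    then have "(mat_adjoint U *\<^sub>v r) $ j = 0"
      unfolding r_def using leading_projector_coords[OF D(5) _ xg j, of k] k by simp
    then show ?thesis by (simp add: K_def)
  next
    case False
    let ?X = "(mat_adjoint U *\<^sub>v x) $ j" and ?g = "(mat_adjoint U *\<^sub>v g) $ j"
    let ?b = "(mat_adjoint U *\<^sub>v (B *\<^sub>v q)) $ j"
    have dj: "0 \<le> d j" "d j \<le> sigma"
      using j k False unfolding d_def sigma_def
      by (auto intro!: full_svd_nonneg[OF svd] full_svd_antimono[OF svd])
    \<comment> \<open>The strict inequality keeps both denominators away from zero, since also \<open>t\<^sup>2 \<le> lam\<close>.\<close>
    have d2: "(d j)\<^sup>2 < t\<^sup>2"
      using dj t by (intro power_strict_mono) (auto simp: sigma_def)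
    have "(mat_adjoint U *\<^sub>v (B *\<^sub>v (mat_adjoint B *\<^sub>v x) + B *\<^sub>v q)) $ j
        = (mat_adjoint U *\<^sub>v (complex_of_real (t\<^sup>2) \<cdot>\<^sub>v x)) $ j"
      by (simp only: eigen)
    then have eX: "complex_of_real ((d j)\<^sup>2) * ?X + ?b = complex_of_real (t\<^sup>2) * ?X"
      using j D(1) unfolding mult_add_distrib_mat_vec[OF Ua Bc Bc] mult_mat_vec[OF Ua x]
      by (simp add: gram[OF x j])
    have "(mat_adjoint U *\<^sub>v (B *\<^sub>v (mat_adjoint B *\<^sub>v g) - complex_of_real lam \<cdot>\<^sub>v g)) $ j = ?b"
      using resolvent unfolding shifted_gram_mult_vec[OF B g] by (rule arg_cong)
    then have eg: "complex_of_real ((d j)\<^sup>2) * ?g - complex_of_real lam * ?g = ?b"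
      using j D(1) g
        mult_minus_distrib_mat_vec[OF Ua Bc, of "complex_of_real lam \<cdot>\<^sub>v g" "mat_adjoint B *\<^sub>v g"]
      unfolding mult_mat_vec[OF Ua g] by (simp add: gram[OF g j])
    have "(mat_adjoint U *\<^sub>v r) $ j = ?X + ?g"
      unfolding r_def using leading_projector_coords[OF D(5) _ xg j, of k] k False j D(1)
        mult_add_distrib_mat_vec[OF Ua x g] by simp
    also have "\<dots> = - (?b * (complex_of_real (t\<^sup>2) - complex_of_real lam)
        / ((complex_of_real ((d j)\<^sup>2) - complex_of_real (t\<^sup>2))
          * (complex_of_real ((d j)\<^sup>2) - complex_of_real lam)))"
      using d2 lam by (intro resolvent_difference[OF eX eg]) (simp_all only: of_real_eq_iff)
    also have "\<dots> = - (complex_of_real (d j * (t\<^sup>2 - lam) / (((d j)\<^sup>2 - t\<^sup>2) * ((d j)\<^sup>2 - lam)))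
        * (if j < n then h $ j else 0))"
      unfolding Bq[OF j] by simp
    finally have "cmod ((mat_adjoint U *\<^sub>v r) $ j)
        = \<bar>d j * (t\<^sup>2 - lam) / (((d j)\<^sup>2 - t\<^sup>2) * ((d j)\<^sup>2 - lam))\<bar> * (if j < n then cmod (h $ j) else 0)"
      by (simp only: norm_minus_cancel norm_mult norm_of_real) simp
    also have "\<dots> \<le> K * (if j < n then cmod (h $ j) else 0)"
      unfolding K_def
      by (intro mult_right_mono filter_difference_mono dj lam) (use t in \<open>auto simp: sigma_def\<close>)
    finally show ?thesis .
  qed
  have "(cvec_norm r)\<^sup>2 = (\<Sum>j<m. (cmod ((mat_adjoint U *\<^sub>v r) $ j))\<^sup>2)"
    by (rule unitary_norm_coords[OF D(5) rc])
  also have "\<dots> \<le> (\<Sum>j<m. (K * (if j < n then cmod (h $ j) else 0))\<^sup>2)"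
    by (intro sum_mono power_mono) (auto simp: coord)
  also have "\<dots> = (\<Sum>j<min m n. K\<^sup>2 * (cmod (h $ j))\<^sup>2)"
    by (intro sum.mono_neutral_cong_right) (auto simp: power_mult_distrib)
  also have "\<dots> \<le> (\<Sum>j<n. K\<^sup>2 * (cmod (h $ j))\<^sup>2)"
    by (rule sum_mono2) auto
  also have "\<dots> = (K * cvec_norm q)\<^sup>2"
    by (simp add: unitary_norm_coords[OF D(6) q] h_def power_mult_distrib sum_distrib_left)
  finally have "cvec_norm r \<le> K * cvec_norm q"
    by (rule power2_le_imp_le) (simp add: K_def)
  then show ?thesis by (simp add: r_def K_def)
qed

section \<open>Approximation from the augmented space\<close>

lemma Z_mat_carrier:
  assumes B: "B \<in> carrier_mat m n" and E: "E \<in> carrier_mat s n" and U: "U \<in> carrier_mat m m"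
    and inv: "invertible_mat (shifted_gram B lam)"
  shows "Z_mat B E U k lam \<in> carrier_mat (m + s) (k + s + s)"
proof -
  let ?L = "leading_cols k U"
  have L: "?L \<in> carrier_mat m k" by (rule leading_cols_carrier[OF U])
  have "the (mat_inverse (shifted_gram B lam)) \<in> carrier_mat m m"
    by (rule mat_inverse_invertible(1)[OF shifted_gram_carrier[OF B] inv])
  then have "B_lam B U k lam \<in> carrier_mat m m"
    unfolding B_lam_def carrier_matD(1)[OF B]
    by (rule mult_carrier_mat[OF complement_projector_carrier[OF U]])
  then have "- (B_lam B U k lam * B * mat_adjoint E) \<in> carrier_mat m s"
    using B E by (intro uminus_carrier_mat mult_carrier_mat[of _ m n] mult_carrier_mat[of _ m m]) auto
  then show ?thesis
    unfolding Z_mat_def carrier_matD(1)[OF B] carrier_matD(1)[OF E]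
    by (intro four_block_carrier_mat append_cols_carrier[OF L]) simp_all
qed

text \<open>The coefficients \<open>U\<^sub>k\<^sup>H x\<close>, \<open>y\<close>, \<open>y\<close> for the three blocks of columns give a vector \<open>z\<close> whose last
block equals \<open>y\<close> and whose upper block is \<open>U\<^sub>k U\<^sub>k\<^sup>H x - (I - U\<^sub>k U\<^sub>k\<^sup>H) g\<close>.\<close>

lemma Z_mat_range_approximant:
  assumes B: "B \<in> carrier_mat m n" and E: "E \<in> carrier_mat s n" and U: "U \<in> carrier_mat m m"
    and inv: "invertible_mat (shifted_gram B lam)"
    and x: "x \<in> carrier_vec m" and y: "y \<in> carrier_vec s"
  obtains z g where "z \<in> mat_range (Z_mat B E U k lam)" "g \<in> carrier_vec m"
    "shifted_gram B lam *\<^sub>v g = B *\<^sub>v (mat_adjoint E *\<^sub>v y)"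
    "cvec_norm ((x @\<^sub>v y) - z) =
      cvec_norm ((1\<^sub>m m - leading_cols k U * mat_adjoint (leading_cols k U)) *\<^sub>v (x + g))"
proof -
  let ?L = "leading_cols k U" and ?G = "the (mat_inverse (shifted_gram B lam))"
  let ?N = "B_lam B U k lam * B * mat_adjoint E"
  define Q where "Q = 1\<^sub>m m - ?L * mat_adjoint ?L"
  define r0 where "r0 = B *\<^sub>v (mat_adjoint E *\<^sub>v y)"
  define g where "g = ?G *\<^sub>v r0"
  have L: "?L \<in> carrier_mat m k" by (rule leading_cols_carrier[OF U])
  have La: "mat_adjoint ?L \<in> carrier_mat k m" by (rule adjoint_carrier[OF L])
  have Ea: "mat_adjoint E \<in> carrier_mat n s" by (rule adjoint_carrier[OF E])
  have Gc: "?G \<in> carrier_mat m m" and GG: "shifted_gram B lam * ?G = 1\<^sub>m m"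
    using mat_inverse_invertible[OF shifted_gram_carrier[OF B] inv] by auto
  have Q: "Q \<in> carrier_mat m m" unfolding Q_def by (rule complement_projector_carrier[OF U])
  have r0: "r0 \<in> carrier_vec m" using B by (simp add: r0_def)
  have g: "g \<in> carrier_vec m" unfolding g_def using Gc by simp
  have resolvent: "shifted_gram B lam *\<^sub>v g = r0"
    unfolding g_def using assoc_mult_mat_vec[OF shifted_gram_carrier[OF B, of lam] Gc r0] r0
    by (simp add: GG)
  have BQ: "B_lam B U k lam = Q * ?G" using B by (simp add: B_lam_def Q_def)
  have Bl: "B_lam B U k lam \<in> carrier_mat m m" unfolding BQ using Q Gc by (rule mult_carrier_mat)
  have N: "?N \<in> carrier_mat m s" using Bl B Ea by (intro mult_carrier_mat)
  have Ny: "?N *\<^sub>v y = Q *\<^sub>v g"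
  proof -
    have "?N *\<^sub>v y = (Q * ?G * B) *\<^sub>v (mat_adjoint E *\<^sub>v y)"
      unfolding BQ by (rule assoc_mult_mat_vec[OF mult_carrier_mat[OF mult_carrier_mat[OF Q Gc] B] Ea y])
    also have "\<dots> = (Q * ?G) *\<^sub>v r0"
      unfolding r0_def by (rule assoc_mult_mat_vec[OF mult_carrier_mat[OF Q Gc] B]) (use E in simp)
    also have "\<dots> = Q *\<^sub>v g"
      unfolding g_def by (rule assoc_mult_mat_vec[OF Q Gc r0])
    finally show ?thesis .
  qed
  \<comment> \<open>The coefficient vector of the approximant is \<open>c\<close>, its upper block is \<open>top\<close>.\<close>
  define a where "a = mat_adjoint ?L *\<^sub>v x"
  have a: "a \<in> carrier_vec k" using L by (simp add: a_def)
  define top where "top = ?L *\<^sub>v a - ?N *\<^sub>v y"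
  have Nm: "- ?N \<in> carrier_mat m s" using N by simp
  have top': "append_cols ?L (- ?N) *\<^sub>v (a @\<^sub>v y) = top"
    unfolding append_cols_mult_vec[OF L Nm a y] top_def
    using N L y by (intro eq_vecI) auto
  have AC: "append_cols ?L (- ?N) \<in> carrier_mat m (k + s)"
    by (rule append_cols_carrier[OF L Nm])
  define c where "c = (a @\<^sub>v y) @\<^sub>v y"
  have Zc: "Z_mat B E U k lam *\<^sub>v c = top @\<^sub>v y"
  proof -
    have "Z_mat B E U k lam *\<^sub>v c
      = (append_cols ?L (- ?N) *\<^sub>v (a @\<^sub>v y) + 0\<^sub>m m s *\<^sub>v y)
        @\<^sub>v (0\<^sub>m s (k + s) *\<^sub>v (a @\<^sub>v y) + 1\<^sub>m s *\<^sub>v y)"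
      unfolding Z_mat_def c_def carrier_matD(1)[OF B] carrier_matD(1)[OF E]
      by (rule four_block_mat_mult_vec[OF AC _ _ _ _ y]) (use a y in auto)
    also have "\<dots> = top @\<^sub>v y"
      unfolding top' using a y N L by (intro arg_cong2[where f = append_vec] eq_vecI) (auto simp: top_def)
    finally show ?thesis .
  qed
  have Zcar: "Z_mat B E U k lam \<in> carrier_mat (m + s) (k + s + s)"
    by (rule Z_mat_carrier[OF B E U inv])
  interpret vec_space "TYPE(complex)" "m + s" .
  have topc: "top \<in> carrier_vec m"
    unfolding top_def by (intro minus_carrier_vec mult_mat_vec_carrier[OF L a] mult_mat_vec_carrier[OF N y])
  have "top @\<^sub>v y \<in> mat_range (Z_mat B E U k lam)"
    unfolding mat_range_def carrier_matD(1)[OF Zcar] col_space_eq[OF Zcar] carrier_matD(2)[OF Zcar]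
    using Zc a y topc by (auto intro!: bexI[of _ c] simp: c_def)
  moreover have "cvec_norm ((x @\<^sub>v y) - (top @\<^sub>v y)) = cvec_norm (Q *\<^sub>v (x + g))"
  proof -
    have LLx: "?L *\<^sub>v a = (?L * mat_adjoint ?L) *\<^sub>v x"
      unfolding a_def by (rule assoc_mult_mat_vec[OF L La x, symmetric])
    have "Q *\<^sub>v x = x - ?L *\<^sub>v a"
      unfolding Q_def LLx
      using minus_mult_distrib_mat_vec[OF one_carrier_mat mult_carrier_mat[OF L La] x] x by simp
    then have "Q *\<^sub>v (x + g) = x - top"
      unfolding mult_add_distrib_mat_vec[OF Q x g] top_def Ny
      using x g Q L by (intro eq_vecI) auto
    then have "(x @\<^sub>v y) - (top @\<^sub>v y) = Q *\<^sub>v (x + g) @\<^sub>v 0\<^sub>v s"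
      using x y topc by (intro eq_vecI) auto
    then have "(cvec_norm ((x @\<^sub>v y) - (top @\<^sub>v y)))\<^sup>2 = (cvec_norm (Q *\<^sub>v (x + g)))\<^sup>2"
      by (simp add: cvec_norm_append cvec_norm_sq[of "0\<^sub>v s"])
    then show ?thesis by (simp only: power2_eq_iff_nonneg cvec_norm_nonneg)
  qed
  ultimately show thesis using that[of "top @\<^sub>v y" g] g resolvent unfolding r0_def Q_def by blast
qed

theorem proposition4p5:
  shows "\<exists>C::real. C > 0 \<and>
    (\<forall>(m::nat) (n::nat) (s::nat) (k::nat) (i::nat) (lam::real)
      (B::complex mat) (E::complex mat)
      (U::complex mat) (S::real mat) (V::complex mat)
      (Uh::complex mat) (Sh::real mat) (Vh::complex mat).
      B \<in> carrier_mat m n \<longrightarrow> E \<in> carrier_mat s n \<longrightarrow>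
      1 \<le> k \<longrightarrow> k < min m n \<longrightarrow>
      full_svd m n B U S V \<longrightarrow>
      full_svd (m + s) n (B @\<^sub>r E) Uh Sh Vh \<longrightarrow>
      lam \<ge> (sing_val Sh 1)^2 \<longrightarrow>
      invertible_mat (shifted_gram B lam) \<longrightarrow>
      1 \<le> i \<longrightarrow> i \<le> k \<longrightarrow>
      sing_val Sh i \<noteq> sing_val S (k + 1) \<longrightarrow>
      (let u = sing_vec Uh i;
           y = vec_last u s;
           gamma = C * cvec_norm (mat_adjoint E *\<^sub>v y);
           sigma = sing_val S (k + 1);
           sigmah = sing_val Sh i
       in \<exists>z. is_arg_min (\<lambda>z. cvec_norm (u - z)) (\<lambda>z. z \<in> mat_range (Z_mat B E U k lam)) z \<and>
              cvec_norm (u - z) \<le>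
                \<bar>gamma * sigma * (sigmah^2 - lam) /
                  ((sigma^2 - sigmah^2) * (sigma^2 - lam))\<bar>))"
proof (intro exI[of _ 1] conjI allI impI)
  fix m n s k i :: nat and lam :: real
    and B E U V Uh Vh :: "complex mat" and S Sh :: "real mat"
  assume B: "B \<in> carrier_mat m n" and E: "E \<in> carrier_mat s n"
    and "1 \<le> k" and k: "k < min m n"
    and svd: "full_svd m n B U S V" and svdh: "full_svd (m + s) n (B @\<^sub>r E) Uh Sh Vh"
    and lam: "(sing_val Sh 1)\<^sup>2 \<le> lam"
    and inv: "invertible_mat (shifted_gram B lam)"
    and i: "1 \<le> i" "i \<le> k" and ne: "sing_val Sh i \<noteq> sing_val S (k + 1)"
  define u where "u = sing_vec Uh i"
  define x where "x = vec_first u m"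
  define y where "y = vec_last u s"
  define sigma where "sigma = sing_val S (k + 1)"
  define t where "t = sing_val Sh i"
  note D = full_svdD[OF svd] and Dh = full_svdD[OF svdh]
  have uc: "u \<in> carrier_vec (m + s)" unfolding u_def by (rule sing_vec_carrier[OF Dh(1)])
  have x: "x \<in> carrier_vec m" and y: "y \<in> carrier_vec s" by (simp_all add: x_def y_def)
  have u: "u = x @\<^sub>v y" using uc by (simp add: x_def y_def)
  have "sigma \<le> sing_val S i"
    unfolding sigma_def using i k by (intro full_svd_antimono[OF svd]) auto
  also have "\<dots> \<le> t"
    unfolding t_def using i k by (intro sing_val_append_rows[OF B E svd svdh]) auto
  finally have st: "sigma < t" using ne by (simp add: sigma_def t_def)
  have "t\<^sup>2 \<le> (sing_val Sh 1)\<^sup>2"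
    unfolding t_def using i k
    by (intro power_mono full_svd_antimono[OF svdh] full_svd_nonneg[OF svdh]) auto
  then have tlam: "t\<^sup>2 \<le> lam" using lam by simp
  have q: "mat_adjoint E *\<^sub>v y \<in> carrier_vec n" using E by simp
  obtain z g where z: "z \<in> mat_range (Z_mat B E U k lam)" and g: "g \<in> carrier_vec m"
    and resolvent: "shifted_gram B lam *\<^sub>v g = B *\<^sub>v (mat_adjoint E *\<^sub>v y)"
    and dist: "cvec_norm ((x @\<^sub>v y) - z) =
      cvec_norm ((1\<^sub>m m - leading_cols k U * mat_adjoint (leading_cols k U)) *\<^sub>v (x + g))"
    by (rule Z_mat_range_approximant[OF B E D(1) inv x y])
  have eigen: "B *\<^sub>v (mat_adjoint B *\<^sub>v x) + B *\<^sub>v (mat_adjoint E *\<^sub>v y)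
      = complex_of_real (t\<^sup>2) \<cdot>\<^sub>v x"
    unfolding x_def y_def u_def t_def
    by (rule gram_left_singular_vector[OF B E svdh]) (use i k in auto)
  have "cvec_norm (u - z)
      \<le> \<bar>sigma * (t\<^sup>2 - lam) / ((sigma\<^sup>2 - t\<^sup>2) * (sigma\<^sup>2 - lam))\<bar> * cvec_norm (mat_adjoint E *\<^sub>v y)"
    unfolding u dist sigma_def
    using deflated_residual_bound[OF B svd k x g q eigen resolvent _ tlam] st
    by (simp add: sigma_def)
  also have "\<dots> = \<bar>1 * cvec_norm (mat_adjoint E *\<^sub>v y) * sigma * (t\<^sup>2 - lam)
      / ((sigma\<^sup>2 - t\<^sup>2) * (sigma\<^sup>2 - lam))\<bar>"
    by (simp add: abs_mult mult_ac)
  finally have bound: "cvec_norm (u - z) \<le> \<dots>" .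
  obtain p where p: "is_arg_min (\<lambda>z. cvec_norm (u - z)) (\<lambda>z. z \<in> mat_range (Z_mat B E U k lam)) p"
    using nearest_point_exists[OF Z_mat_carrier[OF B E D(1) inv] uc] by blast
  then have "cvec_norm (u - p) \<le> cvec_norm (u - z)"
    using z unfolding is_arg_min_linorder by blast
  then show "let u = sing_vec Uh i;
           y = vec_last u s;
           gamma = 1 * cvec_norm (mat_adjoint E *\<^sub>v y);
           sigma = sing_val S (k + 1);
           sigmah = sing_val Sh i
       in \<exists>z. is_arg_min (\<lambda>z. cvec_norm (u - z)) (\<lambda>z. z \<in> mat_range (Z_mat B E U k lam)) z \<and>
              cvec_norm (u - z) \<le>
                \<bar>gamma * sigma * (sigmah^2 - lam) /
                  ((sigma^2 - sigmah^2) * (sigma^2 - lam))\<bar>"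
    unfolding Let_def using p bound
    unfolding u_def y_def sigma_def t_def by (intro exI[of _ p]) auto
qed simp

end
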